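(* Let $c>0$ and let $(\beta_n)$ be a sequence in $[0,1)$ with $\lim_{n\to\infty}\beta_n=0$, and consider $\mathcal{D}_{n,c}^{*\beta_n}$ for $n>3c$. Then for every compact set $B\subset\mathbb{R}^+$ and every $f\in C_{\rho_0}(\mathbb{R}^+)$, $$\lim_{n\to\infty}\mathcal{D}_{n,c}^{*\beta_n}(f,x)=f(x)\quad\text{uniformly in } x\in B.$$
   Context: For $\beta\in[0,1)$, $y\ge 0$, $n\in\mathbb{N}$ and integers $v\ge0$ let $\omega_\beta(v,ny)=ny(ny+v\beta)^{v-1}\frac{e^{-(ny+v\beta)}}{v!}$. For $c>0$, integers $v\ge1$ and $t\ge0$ let $p_{n,v-1,c}(t)=c\,\frac{\Gamma(n/c+v-1)}{\Gamma(v)\Gamma(n/c)}\cdot\frac{(ct)^{v-1}}{(1+ct)^{n/c+v-1}}$. For $n>2c$ put $r_n(x)=\frac{(n-2c)(1-\beta)x}{n}$ and define the King-type operators $$\mathcal{D}_{n,c}^{*\beta}(f,x)=\frac{n-c}{c}\sum_{v=1}^{\infty}\omega_\beta(v,n r_n(x))\int_0^\infty p_{n,v-1,c}(t)f(t)\,dt+e^{-n r_n(x)}f(0),\quad x\ge0$$ (with $\beta=\beta_n$ in $r_n$ when $\beta=\beta_n$). With $\rho_0(x)=1+x^2$, $C_{\rho_0}(\mathbb{R}^+)$ is the set of continuous functions $f$ on $[0,\infty)$ with $|f(x)|\le M_f(1+x^2)$ for some constant $M_f$ and such that $f(x)/\rho_0(x)$ converges as $x\to\infty$. *)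

theory Defs
  imports "HOL-Analysis.Analysis"
begin

definition omega :: "real \<Rightarrow> nat \<Rightarrow> real \<Rightarrow> real" where
  "omega \<beta> v z = z * (z + real v * \<beta>) ^ (v - 1) * exp (-(z + real v * \<beta>)) / fact v"

text \<open>pkern n k c t = p_{n,k,c}(t), i.e. the paper's p_{n,v-1,c} with k = v-1\<close>
definition pkern :: "nat \<Rightarrow> nat \<Rightarrow> real \<Rightarrow> real \<Rightarrow> real" where
  "pkern n k c t = c * Gamma (real n / c + real k) / (Gamma (real k + 1) * Gamma (real n / c))
      * (c * t) ^ k / (1 + c * t) powr (real n / c + real k)"

definition r_n :: "nat \<Rightarrow> real \<Rightarrow> real \<Rightarrow> real \<Rightarrow> real" where
  "r_n n c \<beta> x = (real n - 2 * c) * (1 - \<beta>) * x / real n"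

text \<open>King-type operator; the sum over v>=1 is written with v = Suc k.\<close>
definition Dop :: "nat \<Rightarrow> real \<Rightarrow> real \<Rightarrow> (real \<Rightarrow> real) \<Rightarrow> real \<Rightarrow> real" where
  "Dop n c \<beta> f x =
     (real n - c) / c *
       (\<Sum>k. omega \<beta> (Suc k) (real n * r_n n c \<beta> x) *
              (LINT t:{0..}|lborel. pkern n k c t * f t))
     + exp (- (real n * r_n n c \<beta> x)) * f 0"

definition C_rho0 :: "(real \<Rightarrow> real) set" where
  "C_rho0 = {f. continuous_on {0..} f \<and> (\<exists>M. \<forall>x\<ge>0. \<bar>f x\<bar> \<le> M * (1 + x\<^sup>2))
              \<and> (\<exists>L. ((\<lambda>x. f x / (1 + x\<^sup>2)) \<longlongrightarrow> L) at_top)}"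

end

theory Submission
  imports Defs
begin

text \<open>For \<open>n > 3c\<close> the operator averages \<open>f\<close> against a probability measure on \<open>[0, \<infinity>)\<close> with mean
  exactly \<open>x\<close> and variance \<open>(c x\<^sup>2 + (1 + 1 / (1 - \<beta>)\<^sup>2) x) / (n - 3c)\<close>, while \<open>f\<close> satisfies
  \<open>\<bar>f t - f x\<bar> \<le> e + K (t - x)\<^sup>2\<close> for all \<open>t \<ge> 0\<close> and \<open>x\<close> in a compact set, with \<open>K\<close> independent of
  \<open>x\<close>. The moments of the weights \<open>\<omega>\<^sub>\<beta>\<close> come from differentiating the generating function
  \<open>exp (z w)\<close> in \<open>u = w exp (- \<beta> w)\<close> at \<open>w = 1\<close>. Since \<open>\<beta>\<^sub>n\<close> tends to \<open>0\<close>, only small \<open>\<beta>\<close>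
  matters; for \<open>\<beta> \<le> 1/16\<close> all double series involved converge absolutely for \<open>w \<le> 3/2\<close>.\<close>

section \<open>The generating function of the weights and its differentiation\<close>

text \<open>An \<open>m\<close>-th finite difference kills polynomials of degree below
  \<open>m\<close>. The induction splits off one factor \<open>a + v * b\<close>; its part with
  \<open>v\<close> is absorbed into the binomial coefficient, which lowers \<open>m\<close> by one
  and moves \<open>a\<close> to \<open>a + b\<close>, so \<open>m\<close> and \<open>a\<close> stay
  general.\<close>

lemma sum_alternating_binomial_linear_power:
  fixes a b :: real
  assumes "p < m"
  shows "(\<Sum>v\<le>m. (- 1) ^ v * real (m choose v) * (a + real v * b) ^ p) = 0"
  using assms
proof (induction p arbitrary: m a)
  case 0
  then show ?case using choose_alternating_sum[of m, where ?'a = real] by simp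
next
  case (Suc p)
  then obtain m' where m: "m = Suc m'" and p: "p < m'" by (cases m) auto
  have absorb: "real v * real (Suc m' choose v) = real (Suc m') * real (m' choose (v - 1))"
    if "v \<noteq> 0" for v
    using that Suc_times_binomial[of "v - 1" m']
    by (cases v) (auto simp del: binomial_Suc_Suc of_nat_Suc simp flip: of_nat_mult)
  have "(\<Sum>v\<le>m. (- 1) ^ v * real (m choose v) * (a + real v * b) ^ Suc p)
      = a * (\<Sum>v\<le>m. (- 1) ^ v * real (m choose v) * (a + real v * b) ^ p)
        + b * (\<Sum>v\<le>m. (- 1) ^ v * (real v * real (m choose v)) * (a + real v * b) ^ p)"
    by (simp add: sum_distrib_left algebra_simps flip: sum.distrib)
  \<comment> \<open>The factor \<open>v\<close> removes the summand at \<open>v = 0\<close>, where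
    \<open>absorb\<close> would fail; shifting the index produces the minus sign.\<close>
  also have "(\<Sum>v\<le>m. (- 1) ^ v * (real v * real (m choose v)) * (a + real v * b) ^ p)
     = - real m * (\<Sum>v\<le>m'. (- 1) ^ v * real (m' choose v) * ((a + b) + real v * b) ^ p)"
    unfolding m sum.atMost_Suc_shift sum_distrib_left
    by (simp only: absorb[OF Suc_not_Zero]) (simp add: algebra_simps)
  finally show ?case
    using Suc.IH[of m a] Suc.IH[of m' "a + b"] Suc.prems p by simp
qed

text \<open>The Taylor coefficients of \<open>exp (z w)\<close> in the variable \<open>u = w exp (- \<beta> w)\<close>. Truncated
  subtraction makes \<open>omega \<beta> 0 z\<close> wrong (\<open>z exp (- z)\<close> instead of \<open>exp (- z)\<close>), hence the case
  \<open>v = 0\<close>.\<close>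

definition jain :: "real \<Rightarrow> real \<Rightarrow> nat \<Rightarrow> real" where
  "jain \<beta> z v = (if v = 0 then 1 else z * (z + real v * \<beta>) ^ (v - 1) / fact v)"

text \<open>Since \<open>exp (- \<beta>)\<close> is the value of
  \<open>u = w exp (- \<beta> w)\<close> at \<open>w = 1\<close>, the weights are, up to the factor
  \<open>exp (- z)\<close>, the terms of the generating series at \<open>w = 1\<close>.\<close>

lemma omega_eq_jain:
  "omega \<beta> (Suc k) z = exp (- z) * (jain \<beta> z (Suc k) * (exp (- \<beta>)) ^ Suc k)"
proof -
  have "exp (- (z + real (Suc k) * \<beta>)) = exp (- z) * exp (- \<beta>) ^ Suc k"
    by (simp add: exp_add[symmetric] exp_of_nat_mult[symmetric] algebra_simps)
  then show ?thesis by (simp add: omega_def jain_def)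
qed

lemma power_div_fact_le_exp:
  fixes x :: real
  assumes "0 \<le> x"
  shows "x ^ k / fact k \<le> exp x"
proof -
  have s: "(\<lambda>n. x ^ n / fact n) sums exp x"
    using exp_converges[of x] by (simp add: scaleR_conv_of_real divide_inverse mult.commute)
  have "sum (\<lambda>n. x ^ n / fact n) {k} \<le> (\<Sum>n. x ^ n / fact n)"
    using s assms by (intro sum_le_suminf) (auto simp: sums_iff)
  then show ?thesis using s by (simp add: sums_iff)
qed

lemma exp_quarter_le: "exp (1/4 :: real) \<le> 4/3"
  using exp_ge_add_one_self[of "- 1/4"] by (simp add: exp_minus field_simps)

lemma jain_nonneg: "0 \<le> \<beta> \<Longrightarrow> 0 \<le> z \<Longrightarrow> 0 \<le> jain \<beta> z v"
  by (simp add: jain_def)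

text \<open>With \<open>y = z + v * \<beta>\<close>, one term of the series of
  \<open>exp (4 * y)\<close> gains \<open>4 ^ k\<close> in the denominator and costs
  \<open>exp (4 * \<beta>) ^ v\<close>, which is at most \<open>(4/3) ^ v\<close> since
  \<open>4 * \<beta>\<close> is at most \<open>1/4\<close>. The net ratio is
  \<open>1/3\<close>.\<close>

lemma jain_le:
  assumes "0 \<le> \<beta>" "\<beta> \<le> 1/16" "0 \<le> z"
  shows "jain \<beta> z v \<le> (1 + 4 * z * exp (4 * z)) * (1/3) ^ v"
proof (cases v)
  case 0
  then show ?thesis using assms by (simp add: jain_def)
next
  case (Suc k)
  define y where "y = z + real v * \<beta>"
  have y: "0 \<le> y" using assms by (simp add: y_def)
  have "y ^ k / fact (Suc k) \<le> y ^ k / fact k"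
    using y by (intro divide_left_mono) (auto simp: fact_mono)
  also have "\<dots> = (4 * y) ^ k / fact k / 4 ^ k" by (simp add: power_mult_distrib)
  also have "\<dots> \<le> exp (4 * y) / 4 ^ k"
    using power_div_fact_le_exp[of "4 * y" k] y by (intro divide_right_mono) auto
  also have "exp (4 * y) = exp (4 * z) * exp (4 * \<beta>) ^ v"
    by (simp add: y_def exp_add[symmetric] exp_of_nat_mult[symmetric] algebra_simps)
  also have "\<dots> \<le> exp (4 * z) * (4/3) ^ v"
    using assms(2) exp_quarter_le order_trans[of "exp (4 * \<beta>)" "exp (1/4)" "4/3"]
    by (intro mult_left_mono power_mono) auto
  also have "exp (4 * z) * (4/3) ^ v / 4 ^ k = 4 * exp (4 * z) * (1/3) ^ v"
    by (simp add: Suc power_divide)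
  finally have "y ^ k / fact (Suc k) \<le> 4 * exp (4 * z) * (1/3) ^ v"
    by (simp add: divide_right_mono)
  then have "z * (y ^ k / fact (Suc k)) \<le> z * (4 * exp (4 * z) * (1/3) ^ v)"
    using assms by (intro mult_left_mono)
  then have "jain \<beta> z v \<le> 4 * z * exp (4 * z) * (1/3) ^ v"
    by (simp add: jain_def Suc y_def mult_ac)
  also have "\<dots> \<le> (1 + 4 * z * exp (4 * z)) * (1/3) ^ v"
    by (intro mult_right_mono) auto
  finally show ?thesis .
qed

text \<open>Against the decay \<open>(1/3) ^ v\<close> an argument of size at most \<open>2\<close>
  leaves the ratio \<open>2/3\<close>. The bound \<open>2\<close> is what the absolute convergence
  below needs for \<open>w\<close> up to \<open>3/2\<close>.\<close>

lemma summable_jain: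
  assumes "0 \<le> \<beta>" "\<beta> \<le> 1/16" "0 \<le> z" "\<bar>x\<bar> \<le> 2"
  shows "summable (\<lambda>v. jain \<beta> z v * x ^ v)"
proof (rule summable_comparison_test)
  have "norm (jain \<beta> z v * x ^ v) \<le> (1 + 4 * z * exp (4 * z)) * (2/3) ^ v" for v
  proof -
    have "norm (jain \<beta> z v * x ^ v) = jain \<beta> z v * \<bar>x\<bar> ^ v"
      using assms by (simp add: abs_mult power_abs jain_nonneg)
    also have "\<dots> \<le> ((1 + 4 * z * exp (4 * z)) * (1/3) ^ v) * 2 ^ v"
      using assms by (intro mult_mono jain_le power_mono) auto
    also have "\<dots> = (1 + 4 * z * exp (4 * z)) * (2/3) ^ v"
      by (simp add: power_divide)
    finally show ?thesis .
  qed
  then show "\<exists>N. \<forall>v\<ge>N. norm (jain \<beta> z v * x ^ v) \<le> (1 + 4 * z * exp (4 * z)) * (2/3) ^ v"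
    by blast
  show "summable (\<lambda>v. (1 + 4 * z * exp (4 * z)) * (2/3 :: real) ^ v)"
    by (intro summable_mult summable_geometric) auto
qed

text \<open>The powers of \<open>z + v * \<beta>\<close> with exponents \<open>v - 1\<close> and
  \<open>m - v\<close> combine to exponent \<open>m - 1\<close> for every \<open>v\<close>, and the
  factorials to a binomial coefficient. For \<open>m > 0\<close> this is a vanishing finite
  difference.\<close>

lemma sum_jain_diagonal:
  "(\<Sum>v\<le>m. jain \<beta> z v * w ^ v * ((- (z + real v * \<beta>) * w) ^ (m - v) / fact (m - v)))
     = (if m = 0 then 1 else 0)"
proof (cases m)
  case 0
  then show ?thesis by (simp add: jain_def)
next
  case (Suc p)
  have "jain \<beta> z v * w ^ v * ((- (z + real v * \<beta>) * w) ^ (m - v) / fact (m - v))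
      = (z * w ^ m * (- 1) ^ m / fact m) * ((- 1) ^ v * real (m choose v) * (z + real v * \<beta>) ^ p)"
    (is "?l = ?r") if "v \<le> m" for v
  proof -
    define y where "y = z + real v * \<beta>"
    \<comment> \<open>At \<open>v = 0\<close> the value \<open>1\<close> of \<open>jain\<close> fits
      as well, because then \<open>y = z\<close> and \<open>y ^ m = z * y ^ p\<close>.\<close>
    have j: "jain \<beta> z v * y ^ (m - v) = z * y ^ p / fact v"
    proof (cases v)
      case 0
      then show ?thesis using Suc by (simp add: jain_def y_def)
    next
      case (Suc k)
      with \<open>m = Suc p\<close> \<open>v \<le> m\<close> have "k + (p - k) = p" by simp
      then show ?thesis using Suc \<open>m = Suc p\<close>
        by (simp add: jain_def y_def mult.assoc flip: power_add)
    qed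
    have s: "(- 1 :: real) ^ (m - v) = (- 1) ^ m * (- 1) ^ v"
      using that by (simp add: uminus_power_if)
    have "?l = (jain \<beta> z v * y ^ (m - v)) * (w ^ v * w ^ (m - v)) * (- 1) ^ (m - v) / fact (m - v)"
      unfolding y_def[symmetric] power_mult_distrib power_minus[of y] by simp
    also have "\<dots> = (z * y ^ p / fact v) * w ^ m * ((- 1) ^ m * (- 1) ^ v) / fact (m - v)"
      using that by (simp add: j s flip: power_add)
    also have "\<dots> = ?r"
      using that by (simp add: binomial_fact y_def field_simps)
    finally show ?thesis .
  qed
  then have "(\<Sum>v\<le>m. jain \<beta> z v * w ^ v * ((- (z + real v * \<beta>) * w) ^ (m - v) / fact (m - v)))
     = (z * w ^ m * (- 1) ^ m / fact m)
        * (\<Sum>v\<le>m. (- 1) ^ v * real (m choose v) * (z + real v * \<beta>) ^ p)"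
    by (simp add: sum_distrib_left)
  then show ?thesis
    using Suc sum_alternating_binomial_linear_power[of p m z \<beta>] by simp
qed

text \<open>Expanding the exponentials into powers of \<open>w\<close> turns the coefficient of \<open>w ^ m\<close> into an
  \<open>m\<close>-th finite difference of a polynomial of degree \<open>m - 1\<close>.\<close>

lemma jain_generating_function:
  assumes "0 \<le> \<beta>" "\<beta> \<le> 1/16" "0 \<le> z" "0 \<le> w" "w \<le> 3/2"
  shows "(\<lambda>v. jain \<beta> z v * (w * exp (- \<beta> * w)) ^ v) sums exp (z * w)"
proof -
  \<comment> \<open>Row \<open>v\<close> sums to \<open>exp (- z * w)\<close> times the
    \<open>v\<close>-th term of the claimed series, so it suffices that the whole double family sums
    to \<open>1\<close>.\<close>
  define g where "g = (\<lambda>(v, j). jain \<beta> z v * w ^ v * ((- (z + real v * \<beta>) * w) ^ j / fact j))"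
  have exp_sum: "((\<lambda>j. x ^ j / fact j) has_sum exp x) UNIV" for x :: real
  proof (rule norm_summable_imp_has_sum)
    show "(\<lambda>j. x ^ j / fact j) sums exp x"
      using exp_converges[of x] by (simp add: scaleR_conv_of_real divide_inverse mult.commute)
    show "summable (\<lambda>j. norm (x ^ j / fact j))"
      using summable_norm_exp[of x] by (simp add: divide_inverse mult.commute)
  qed
  have rows: "((\<lambda>j. g (v, j)) has_sum jain \<beta> z v * w ^ v * exp (- (z + real v * \<beta>) * w)) UNIV" for v
    unfolding g_def prod.case by (intro has_sum_cmult_right exp_sum)
  have norm_rows: "((\<lambda>j. norm (g (v, j))) has_sum jain \<beta> z v * w ^ v * exp ((z + real v * \<beta>) * w)) UNIV" for v
  proof -
    have "norm (g (v, j)) = jain \<beta> z v * w ^ v * (((z + real v * \<beta>) * w) ^ j / fact j)" for j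
      using assms by (simp add: g_def abs_mult power_abs jain_nonneg del: minus_add_distrib)
    then show ?thesis by (simp only:) (intro has_sum_cmult_right exp_sum)
  qed
  \<comment> \<open>Taking norms turns \<open>exp (- \<beta> * w)\<close> into
    \<open>exp (\<beta> * w)\<close> in the row sums, so the power series is needed at this larger
    argument.\<close>
  have weight: "w * exp (\<beta> * w) \<le> 2"
  proof -
    have "\<beta> * w \<le> 1/16 * (3/2)" using assms by (intro mult_mono) auto
    then have "exp (\<beta> * w) \<le> 4/3" using exp_quarter_le by (intro order_trans[OF _ exp_quarter_le]) auto
    then have "w * exp (\<beta> * w) \<le> 3/2 * (4/3)" using assms by (intro mult_mono) auto
    then show ?thesis by simp
  qed
  have "summable (\<lambda>v. jain \<beta> z v * (w * exp (\<beta> * w)) ^ v * exp (z * w))"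
    using assms weight by (intro summable_mult2 summable_jain) auto
  also have "(\<lambda>v. jain \<beta> z v * (w * exp (\<beta> * w)) ^ v * exp (z * w))
      = (\<lambda>v. jain \<beta> z v * w ^ v * exp ((z + real v * \<beta>) * w))"
    by (simp add: power_mult_distrib exp_add[symmetric] exp_of_nat_mult[symmetric] algebra_simps)
  finally have "(\<lambda>p. norm (g p)) summable_on (UNIV \<times> UNIV)"
    unfolding Infinite_Sum.abs_summable_on_Sigma_iff
    using norm_rows assms
    by (auto simp: infsumI[OF norm_rows] jain_nonneg abs_mult has_sum_iff
             intro!: norm_summable_imp_summable_on)
  then have "g summable_on (UNIV \<times> UNIV)" by (rule Infinite_Sum.abs_summable_summable)
  then obtain S where S: "(g has_sum S) (UNIV \<times> UNIV)" by (auto simp: summable_on_def)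
  \<comment> \<open>Regrouping by the exponent \<open>m = v + j\<close> of \<open>w\<close>;
    afterwards only the diagonal \<open>m = 0\<close> contributes.\<close>
  have "(g has_sum S) (UNIV \<times> UNIV) \<longleftrightarrow> ((\<lambda>(m, v). g (v, m - v)) has_sum S) (SIGMA m:UNIV. {..m})"
    by (rule has_sum_reindex_bij_witness[where j = "\<lambda>(v, j). (v + j, v)" and i = "\<lambda>(m, v). (v, m - v)"]) auto
  with S have "((\<lambda>(m, v). g (v, m - v)) has_sum S) (SIGMA m:UNIV. {..m})" by simp
  moreover have "((\<lambda>v. case (m, v) of (m, v) \<Rightarrow> g (v, m - v)) has_sum (if m = 0 then 1 else 0)) {..m}" for m
    by (rule has_sum_finiteI) (simp_all only: g_def prod.case sum_jain_diagonal finite_atMost)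
  ultimately have "((\<lambda>m. if m = 0 then 1 else 0) has_sum S) (UNIV :: nat set)"
    by (rule has_sum_SigmaD)
  moreover have "((\<lambda>m. if m = 0 then 1 else 0) has_sum (1 :: real)) (UNIV :: nat set)"
    by (rule has_sum_finite_neutralI[of "{0}"]) auto
  ultimately have "S = 1" by (rule has_sum_unique)
  have "(\<lambda>v. jain \<beta> z v * w ^ v * exp (- (z + real v * \<beta>) * w)) sums 1"
    using has_sum_SigmaD[OF S rows] \<open>S = 1\<close> by (intro has_sum_imp_sums) simp
  then have "(\<lambda>v. exp (z * w) * (jain \<beta> z v * w ^ v * exp (- (z + real v * \<beta>) * w))) sums (exp (z * w) * 1)"
    by (rule sums_mult)
  also have "(\<lambda>v. exp (z * w) * (jain \<beta> z v * w ^ v * exp (- (z + real v * \<beta>) * w)))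
      = (\<lambda>v. jain \<beta> z v * (w * exp (- \<beta> * w)) ^ v)"
  proof
    fix v
    have "exp (z * w) * exp (- (z + real v * \<beta>) * w) = exp (- \<beta> * w) ^ v"
      by (simp add: exp_add[symmetric] exp_of_nat_mult[symmetric] algebra_simps)
    then show "exp (z * w) * (jain \<beta> z v * w ^ v * exp (- (z + real v * \<beta>) * w))
        = jain \<beta> z v * (w * exp (- \<beta> * w)) ^ v"
      by (simp add: power_mult_distrib mult.left_commute)
  qed
  finally show ?thesis by simp
qed

text \<open>Applying \<open>u d/du\<close> to a power series in \<open>u = w exp (- \<beta> w)\<close>, where
  \<open>u / (du/dw) = w / (1 - \<beta> w)\<close>.\<close>

lemma sums_euler_derivative:
  fixes a :: "nat \<Rightarrow> real"
  assumes \<beta>: "0 \<le> \<beta>" "\<beta> \<le> 1/16"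
    and summ: "\<And>x. \<bar>x\<bar> < 2 \<Longrightarrow> summable (\<lambda>n. a n * x ^ n)"
    and sums: "\<And>w. 0 < w \<Longrightarrow> w < 3/2 \<Longrightarrow> (\<lambda>n. a n * (w * exp (- \<beta> * w)) ^ n) sums G w"
    and deriv: "(G has_real_derivative G') (at w)"
    and w: "0 < w" "w < 3/2"
  shows "(\<lambda>n. real n * a n * (w * exp (- \<beta> * w)) ^ n) sums (w * G' / (1 - \<beta> * w))"
proof -
  define u where "u = (\<lambda>w. w * exp (- \<beta> * w))"
  define F where "F = (\<lambda>x. \<Sum>n. a n * x ^ n)"
  define F' where "F' = (\<Sum>n. diffs a n * u w ^ n)"
  have "exp (- \<beta> * w) \<le> 1" using \<beta> w by simp
  then have "u w \<le> w * 1" unfolding u_def using w by (intro mult_left_mono) auto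
  moreover have "0 < u w" using w by (simp add: u_def)
  ultimately have u: "\<bar>u w\<bar> < 2" using w by linarith
  have \<beta>w: "1 - \<beta> * w > 0"
    using mult_mono[of \<beta> "1/16" w "3/2"] \<beta> w by simp
  have "(F has_real_derivative F') (at (u w))"
    unfolding F_def F'_def by (rule termdiffs_strong'[of 2]) (use u summ in auto)
  moreover have "(u has_real_derivative (1 - \<beta> * w) * exp (- \<beta> * w)) (at w)"
    unfolding u_def by (auto intro!: derivative_eq_intros simp: algebra_simps)
  ultimately have "((\<lambda>w. F (u w)) has_real_derivative F' * ((1 - \<beta> * w) * exp (- \<beta> * w))) (at w)"
    by (rule DERIV_chain2)
  \<comment> \<open>On the open interval around \<open>w\<close> the composite is \<open>G\<close>,
    so its derivative is known in two ways; uniqueness then determines \<open>F'\<close>.\<close>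
  moreover have "((\<lambda>w. F (u w)) has_real_derivative G') (at w)"
    by (rule has_field_derivative_transform_within_open[OF deriv, of "{0<..<3/2}"])
       (use w sums in \<open>auto simp: F_def u_def sums_iff\<close>)
  ultimately have G': "G' = F' * ((1 - \<beta> * w) * exp (- \<beta> * w))"
    by (rule DERIV_unique[symmetric])
  have "summable (\<lambda>n. diffs a n * u w ^ n)"
    by (rule termdiff_converges[of _ 2]) (use u summ in auto)
  then have "(\<lambda>n. real n * a n * u w ^ (n - Suc 0)) sums F'"
    unfolding F'_def by (rule diffs_equiv)
  then have "(\<lambda>n. u w * (real n * a n * u w ^ (n - Suc 0))) sums (u w * F')"
    by (rule sums_mult)
  also have "(\<lambda>n. u w * (real n * a n * u w ^ (n - Suc 0))) = (\<lambda>n. real n * a n * u w ^ n)"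
  proof
    fix n
    show "u w * (real n * a n * u w ^ (n - Suc 0)) = real n * a n * u w ^ n"
      by (cases n) auto
  qed
  also have "u w * F' = w * G' / (1 - \<beta> * w)"
    using \<beta>w by (simp add: G' u_def)
  finally show ?thesis by (simp add: u_def)
qed

text \<open>Termwise differentiation preserves convergence inside the disc, and multiplying by
  \<open>x\<close> restores the exponent. This permits a second application of the Euler
  operator.\<close>

lemma summable_of_nat_mult_powser:
  fixes a :: "nat \<Rightarrow> real"
  assumes "\<And>x. \<bar>x\<bar> < r \<Longrightarrow> summable (\<lambda>n. a n * x ^ n)" and "\<bar>x\<bar> < r"
  shows "summable (\<lambda>n. real n * a n * x ^ n)"
proof -
  have "summable (\<lambda>n. diffs a n * x ^ n)"
    by (rule termdiff_converges[of _ r]) (use assms in auto)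
  then have "summable (\<lambda>n. x * (real n * a n * x ^ (n - Suc 0)))"
    by (intro summable_mult) (use diffs_equiv in \<open>blast intro: sums_summable\<close>)
  also have "(\<lambda>n. x * (real n * a n * x ^ (n - Suc 0))) = (\<lambda>n. real n * a n * x ^ n)"
  proof
    fix n
    show "x * (real n * a n * x ^ (n - Suc 0)) = real n * a n * x ^ n"
      by (cases n) auto
  qed
  finally show ?thesis .
qed

section \<open>Moments of the weights\<close>

text \<open>The generating function and its first two Euler derivatives at \<open>w = 1\<close>, an
  interior point of the range of \<open>w\<close>, normalised by \<open>exp (- z)\<close>. The mass
  \<open>exp (- z)\<close> missing from the total belongs to index \<open>0\<close>.\<close>

lemma omega_moments:
  assumes \<beta>: "0 \<le> \<beta>" "\<beta> \<le> 1/16" and z: "0 \<le> z"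
  shows "(\<lambda>k. omega \<beta> (Suc k) z) sums (1 - exp (- z))"
    and "(\<lambda>k. omega \<beta> (Suc k) z * real (Suc k)) sums (z / (1 - \<beta>))"
    and "(\<lambda>k. omega \<beta> (Suc k) z * (real (Suc k))\<^sup>2) sums ((z / (1 - \<beta>))\<^sup>2 + z / (1 - \<beta>) ^ 3)"
proof -
  define a1 where "a1 = (\<lambda>n. real n * jain \<beta> z n)"
  have summ0: "summable (\<lambda>n. jain \<beta> z n * x ^ n)" if "\<bar>x\<bar> < 2" for x
    using summable_jain[OF \<beta> z] that by simp
  have summ1: "summable (\<lambda>n. a1 n * x ^ n)" if "\<bar>x\<bar> < 2" for x
    unfolding a1_def by (rule summable_of_nat_mult_powser[OF summ0 that])
  have pos: "1 - \<beta> * w > 0" if "0 < w" "w < 3/2" for w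
    using mult_mono[of \<beta> "1/16" w "3/2"] \<beta> that by simp
  have sums0: "(\<lambda>n. jain \<beta> z n * (w * exp (- \<beta> * w)) ^ n) sums exp (z * w)"
    if "0 < w" "w < 3/2" for w
    using jain_generating_function[OF \<beta> z, of w] that by simp
  \<comment> \<open>Needed for all \<open>w\<close> near \<open>1\<close>, since this identity is
    differentiated once more.\<close>
  have sums1: "(\<lambda>n. a1 n * (w * exp (- \<beta> * w)) ^ n) sums (w * (z * exp (z * w)) / (1 - \<beta> * w))"
    if w: "0 < w" "w < 3/2" for w
    unfolding a1_def
    by (rule sums_euler_derivative[OF \<beta> summ0 sums0 _ w]) (auto intro!: derivative_eq_intros)
  have sums2: "(\<lambda>n. real n * a1 n * (1 * exp (- \<beta> * 1)) ^ n)
      sums (1 * (exp z * (z + z\<^sup>2) / (1 - \<beta>) + exp z * z * \<beta> / (1 - \<beta>)\<^sup>2) / (1 - \<beta> * 1))"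
  proof (rule sums_euler_derivative[OF \<beta> summ1 sums1])
    have "((\<lambda>w. w * (z * exp (z * w))) has_real_derivative exp z * (z + z\<^sup>2)) (at 1)"
      by (auto intro!: derivative_eq_intros simp: algebra_simps power2_eq_square)
    moreover have "((\<lambda>w. 1 - \<beta> * w) has_real_derivative - \<beta>) (at 1)"
      by (auto intro!: derivative_eq_intros)
    ultimately show "((\<lambda>w. w * (z * exp (z * w)) / (1 - \<beta> * w)) has_real_derivative
        exp z * (z + z\<^sup>2) / (1 - \<beta>) + exp z * z * \<beta> / (1 - \<beta>)\<^sup>2) (at 1)"
      by (rule DERIV_cong[OF DERIV_divide])
         (use \<beta> in \<open>simp_all add: add_divide_distrib power2_eq_square mult_ac\<close>)
  qed auto
  \<comment> \<open>Dropping the term of index \<open>0\<close> subtracts \<open>1\<close> from the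
    sum for \<open>i = 0\<close> and nothing for higher powers.\<close>
  have shift: "(\<lambda>k. omega \<beta> (Suc k) z * real (Suc k) ^ i) sums (exp (- z) * (s - (if i = 0 then 1 else 0)))"
    if "(\<lambda>n. real n ^ i * jain \<beta> z n * exp (- \<beta>) ^ n) sums s" for i s
  proof -
    have "(\<lambda>k. real (Suc k) ^ i * jain \<beta> z (Suc k) * exp (- \<beta>) ^ Suc k) sums (s - (if i = 0 then 1 else 0))"
      using that by (subst sums_Suc_iff) (auto simp: jain_def power_0_left)
    from sums_mult[OF this, of "exp (- z)"] show ?thesis
      by (simp only: omega_eq_jain mult_ac)
  qed
  have e: "exp (- z) * exp z = 1" by (simp flip: exp_add)
  have ne: "1 - \<beta> \<noteq> 0" using \<beta> by simp
  show "(\<lambda>k. omega \<beta> (Suc k) z) sums (1 - exp (- z))"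
    using shift[of 0 "exp z"] sums0[of 1] e by (simp add: algebra_simps)
  show "(\<lambda>k. omega \<beta> (Suc k) z * real (Suc k)) sums (z / (1 - \<beta>))"
    using shift[of 1 "z * exp z / (1 - \<beta>)"] sums1[of 1] e by (simp add: a1_def field_simps)
  let ?s = "(exp z * (z + z\<^sup>2) / (1 - \<beta>) + exp z * z * \<beta> / (1 - \<beta>)\<^sup>2) / (1 - \<beta>)"
  have "exp (- z) * ?s = (exp (- z) * exp z) * ((z + z\<^sup>2) / (1 - \<beta>) + z * \<beta> / (1 - \<beta>)\<^sup>2) / (1 - \<beta>)"
    by (simp add: algebra_simps add_divide_distrib)
  \<comment> \<open>The terms linear in \<open>z\<close> combine because
    \<open>(1 - \<beta>) + \<beta> = 1\<close>.\<close>
  also have "\<dots> = (z / (1 - \<beta>))\<^sup>2 + z / (1 - \<beta>) ^ 3"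
  proof -
    define q where "q = 1 - \<beta>"
    have \<beta>q: "\<beta> = 1 - q" and "q \<noteq> 0" using ne by (auto simp: q_def)
    from \<open>q \<noteq> 0\<close> show ?thesis
      unfolding e \<beta>q by (simp add: field_simps power2_eq_square power3_eq_cube)
  qed
  finally show "(\<lambda>k. omega \<beta> (Suc k) z * (real (Suc k))\<^sup>2) sums ((z / (1 - \<beta>))\<^sup>2 + z / (1 - \<beta>) ^ 3)"
    using shift[of 2 ?s] sums2 by (simp add: a1_def power2_eq_square mult_ac)
qed

lemma omega_nonneg: "0 \<le> \<beta> \<Longrightarrow> 0 \<le> z \<Longrightarrow> 0 \<le> omega \<beta> v z"
  by (simp add: omega_def)

section \<open>Moments of the Beta-type kernel\<close>

lemma has_bochner_integral_powr_atLeast_0: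
  fixes c s :: real
  assumes c: "c > 0" and s: "s > 1"
  shows "has_bochner_integral lborel (\<lambda>t. indicator {0..} t * (1 + c * t) powr (- s)) (1 / (c * (s - 1)))"
proof (rule has_bochner_integral_nn_integral)
  \<comment> \<open>An antiderivative of the integrand; it vanishes at infinity because
    \<open>s > 1\<close>.\<close>
  let ?F = "\<lambda>t. - ((1 + c * t) powr (1 - s)) / (c * (s - 1))"
  have "((\<lambda>t. (1 + c * t) powr (1 - s)) \<longlongrightarrow> 0) at_top"
    by (rule tendsto_neg_powr)
       (use c s in \<open>auto intro!: filterlim_tendsto_add_at_top[OF tendsto_const]
          filterlim_tendsto_pos_mult_at_top[OF tendsto_const] filterlim_ident\<close>)
  then have lim: "(?F \<longlongrightarrow> - 0 / (c * (s - 1))) at_top"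
    by (intro tendsto_intros) (use c s in auto)
  have "(\<integral>\<^sup>+t. ennreal ((1 + c * t) powr (- s)) * indicator {0..} t \<partial>lborel) = - 0 / (c * (s - 1)) - ?F 0"
  proof (rule nn_integral_FTC_atLeast[OF _ _ _ lim])
    fix t :: real
    assume "0 \<le> t"
    then have "1 + c * t > 0" using c by (simp add: add_pos_nonneg)
    then have "((\<lambda>t. (1 + c * t) powr (1 - s)) has_real_derivative
        (1 - s) * (1 + c * t) powr (1 - s - of_nat 1) * c) (at t)"
      by (intro DERIV_fun_powr) (auto intro!: derivative_eq_intros)
    from DERIV_cdivide[OF DERIV_minus[OF this], of "c * (s - 1)"]
    show "(?F has_real_derivative (1 + c * t) powr (- s)) (at t)"
      by (rule DERIV_cong) (use c s in \<open>simp add: field_simps\<close>)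
  qed auto
  then show "(\<integral>\<^sup>+t. ennreal (indicator {0..} t * (1 + c * t) powr (- s)) \<partial>lborel) = ennreal (1 / (c * (s - 1)))"
    by (simp add: indicator_mult_ennreal mult.commute)
qed (use c s in auto)

text \<open>The value is \<open>1 / c\<close> times the Beta function at \<open>k + 1\<close> and
  \<open>s - k - 1\<close>. Writing one factor \<open>c * t\<close> as
  \<open>(1 + c * t) - 1\<close> lowers \<open>k\<close> at the price of the two exponents
  \<open>s - 1\<close> and \<open>s\<close>, hence the induction over arbitrary
  \<open>s\<close>.\<close>

lemma has_bochner_integral_beta_atLeast_0:
  fixes c s :: real
  assumes c: "c > 0" and s: "s > real k + 1"
  shows "has_bochner_integral lborel (\<lambda>t. indicator {0..} t * ((c * t) ^ k * (1 + c * t) powr (- s)))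
           (fact k * Gamma (s - real k - 1) / (c * Gamma s))"
  using s
proof (induction k arbitrary: s)
  case 0
  then have "Gamma s = (s - 1) * Gamma (s - 1)" "Gamma (s - 1) > 0"
    using Gamma_plus1[of "s - 1"] Gamma_real_pos[of "s - 1"] by (auto simp: nonpos_Ints_def)
  then have "fact 0 * Gamma (s - real 0 - 1) / (c * Gamma s) = 1 / (c * (s - 1))" by simp
  with 0 show ?case
    using has_bochner_integral_powr_atLeast_0[OF c, of s] by (simp only: power_0 mult_1)
next
  case (Suc k)
  from Suc.prems have s: "s > real k + 2" by simp
  let ?J = "\<lambda>k s t. indicator {0..} t * ((c * t) ^ k * (1 + c * t) powr (- s)) :: real"
  have "has_bochner_integral lborel (\<lambda>t. ?J k (s - 1) t - ?J k s t)
      (fact k * Gamma (s - 1 - real k - 1) / (c * Gamma (s - 1)) - fact k * Gamma (s - real k - 1) / (c * Gamma s))"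
    using s by (intro has_bochner_integral_diff Suc.IH) auto
  moreover have "?J k (s - 1) t - ?J k s t = ?J (Suc k) s t" for t
  proof (cases "t \<ge> 0")
    case True
    then have "(1 + c * t) powr (- (s - 1)) = (1 + c * t) * (1 + c * t) powr (- s)"
      using c by (simp add: powr_diff powr_minus field_simps add_pos_nonneg)
    then show ?thesis by (simp add: algebra_simps)
  qed auto
  moreover have "fact k * Gamma (s - 1 - real k - 1) / (c * Gamma (s - 1)) - fact k * Gamma (s - real k - 1) / (c * Gamma s)
      = fact (Suc k) * Gamma (s - real (Suc k) - 1) / (c * Gamma s)"
  proof -
    define g where "g = Gamma (s - real k - 2)"
    define h where "h = Gamma (s - 1)"
    have G1: "Gamma s = (s - 1) * h"
      using s Gamma_plus1[of "s - 1"] by (auto simp: nonpos_Ints_def h_def)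
    have G2: "Gamma (s - real k - 1) = (s - real k - 2) * g"
      using s Gamma_plus1[of "s - real k - 2"] by (auto simp: nonpos_Ints_def g_def algebra_simps)
    have "h > 0" using s unfolding h_def by (intro Gamma_real_pos) auto
    moreover have shift: "s - 1 - real k - 1 = s - real k - 2" "s - real (Suc k) - 1 = s - real k - 2" by auto
    ultimately show ?thesis
      using c s unfolding shift G1 G2 g_def[symmetric] h_def[symmetric] by (simp add: field_simps)
  qed
  ultimately show ?case by simp
qed

text \<open>The factor \<open>t ^ j\<close> only raises the power in the Beta integral from
  \<open>k\<close> to \<open>k + j\<close>, and the \<open>Gamma\<close> factor depending on
  \<open>n / c + k\<close> cancels. The hypothesis on \<open>n\<close> is the convergence condition
  of that integral.\<close>

lemma has_bochner_integral_pkern_moment: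
  assumes c: "c > 0" and n: "real n > (real j + 1) * c"
  shows "has_bochner_integral lborel (\<lambda>t. indicator {0..} t * (pkern n k c t * t ^ j))
           (fact (k + j) / fact k / c ^ j * (Gamma (real n / c - real j - 1) / Gamma (real n / c)))"
proof -
  define N where "N = real n / c"
  have N: "N > real j + 1" using assms by (simp add: N_def field_simps)
  have g: "Gamma (N + real k) > 0" "Gamma N > 0" using N by (auto intro!: Gamma_real_pos)
  have Gf: "Gamma (real k + 1) = fact k" by (simp add: Gamma_fact add.commute)
  define C where "C = c * Gamma (N + real k) / (fact k * Gamma N) / c ^ j"
  have "has_bochner_integral lborel
      (\<lambda>t. C * (indicator {0..} t * ((c * t) ^ (k + j) * (1 + c * t) powr (- (N + real k)))))
      (C * (fact (k + j) * Gamma (N + real k - real (k + j) - 1) / (c * Gamma (N + real k))))"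
    using N by (intro has_bochner_integral_mult_right has_bochner_integral_beta_atLeast_0 c) auto
  moreover have "C * (indicator {0..} t * ((c * t) ^ (k + j) * (1 + c * t) powr (- (N + real k))))
      = indicator {0..} t * (pkern n k c t * t ^ j)" for t
    unfolding C_def pkern_def N_def[symmetric] Gf powr_minus_divide
    using c by (simp add: power_add power_mult_distrib)
  moreover have "C * (fact (k + j) * Gamma (N + real k - real (k + j) - 1) / (c * Gamma (N + real k)))
      = fact (k + j) / fact k / c ^ j * (Gamma (N - real j - 1) / Gamma N)"
    using c g by (simp add: C_def field_simps)
  ultimately show ?thesis by (simp only: N_def[symmetric])
qed

text \<open>The prefactor \<open>(n - c) / c\<close> normalises the kernel to a probability density;
  \<open>n > 3 * c\<close> makes its second moment finite.\<close>

lemma pkern_moments: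
  assumes c: "c > 0" and n: "real n > 3 * c"
  shows "has_bochner_integral lborel (\<lambda>t. indicator {0..} t * ((real n - c) / c * pkern n k c t)) 1"
    and "has_bochner_integral lborel (\<lambda>t. indicator {0..} t * ((real n - c) / c * pkern n k c t) * t)
           (real (Suc k) / (real n - 2 * c))"
    and "has_bochner_integral lborel (\<lambda>t. indicator {0..} t * ((real n - c) / c * pkern n k c t) * t\<^sup>2)
           (real (Suc k) * (real (Suc k) + 1) / ((real n - 2 * c) * (real n - 3 * c)))"
proof -
  define N where "N = real n / c"
  have nN: "real n = c * N" using c by (simp add: N_def)
  have N: "N > 3" using assms by (simp add: N_def field_simps)
  \<comment> \<open>All \<open>Gamma\<close> quotients become rational functions of \<open>N\<close>
    once expressed through \<open>Gamma (N - 3)\<close>.\<close>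
  define g where "g = Gamma (N - 3)"
  have g: "g > 0" using N by (auto simp: g_def intro!: Gamma_real_pos)
  have G1: "Gamma (N - 2) = (N - 3) * g"
    using N Gamma_plus1[of "N - 3"] by (auto simp: nonpos_Ints_def g_def algebra_simps)
  have G2: "Gamma (N - 1) = (N - 2) * ((N - 3) * g)"
    using N Gamma_plus1[of "N - 2"] G1 by (auto simp: nonpos_Ints_def)
  have G3: "Gamma N = (N - 1) * ((N - 2) * ((N - 3) * g))"
    using N Gamma_plus1[of "N - 1"] G2 by (auto simp: nonpos_Ints_def)
  have J: "has_bochner_integral lborel (\<lambda>t. indicator {0..} t * ((real n - c) / c * pkern n k c t) * t ^ j)
      ((N - 1) * (fact (k + j) / fact k / c ^ j * (Gamma (N - real j - 1) / Gamma N)))" if "j \<le> 2" for j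
  proof -
    have "(real j + 1) * c \<le> 3 * c" using that c by (intro mult_right_mono) auto
    then have "real n > (real j + 1) * c" using n by linarith
    from has_bochner_integral_mult_right[OF has_bochner_integral_pkern_moment[OF c this, of k], of "N - 1"]
    have "has_bochner_integral lborel (\<lambda>t. (N - 1) * (indicator {0..} t * (pkern n k c t * t ^ j)))
      ((N - 1) * (fact (k + j) / fact k / c ^ j * (Gamma (N - real j - 1) / Gamma N)))"
      by (simp add: N_def)
    moreover have "(real n - c) / c = N - 1" using c by (simp add: N_def field_simps)
    ultimately show ?thesis by (simp add: mult_ac)
  qed
  have gs: "g \<noteq> 0" "N \<noteq> 1" "N \<noteq> 2" "N \<noteq> 3" "c \<noteq> 0" using g N c by auto
  have d: "real n - 2 * c = c * (N - 2)" "real n - 3 * c = c * (N - 3)"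
    by (simp_all add: nN algebra_simps)
  show "has_bochner_integral lborel (\<lambda>t. indicator {0..} t * ((real n - c) / c * pkern n k c t)) 1"
  proof -
    have "(N - 1) * (fact (k + 0) / fact k / c ^ 0 * (Gamma (N - real 0 - 1) / Gamma N)) = 1"
      using gs by (simp add: G2 G3)
    then show ?thesis using J[of 0] by (simp only: power_0 mult_1_right mult_1)
  qed
  have "(N - 1) * (fact (k + 1) / fact k / c ^ 1 * (Gamma (N - real 1 - 1) / Gamma N))
     = real (Suc k) / (real n - 2 * c)"
    using gs by (simp add: d G1 G3 divide_simps)
  then show "has_bochner_integral lborel (\<lambda>t. indicator {0..} t * ((real n - c) / c * pkern n k c t) * t)
           (real (Suc k) / (real n - 2 * c))"
    using J[of 1] by (simp only: power_one_right)
  have "(N - 1) * (fact (k + 2) / fact k / c ^ 2 * (Gamma (N - real 2 - 1) / Gamma N))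
     = real (Suc k) * (real (Suc k) + 1) / ((real n - 2 * c) * (real n - 3 * c))"
    using gs by (simp add: d G3 g_def[symmetric] divide_simps power2_eq_square)
  then show "has_bochner_integral lborel (\<lambda>t. indicator {0..} t * ((real n - c) / c * pkern n k c t) * t\<^sup>2)
           (real (Suc k) * (real (Suc k) + 1) / ((real n - 2 * c) * (real n - 3 * c)))"
    using J[of 2] by simp
qed

lemma pkern_nonneg:
  assumes "c > 0" "real n > 0" "t \<ge> 0"
  shows "0 \<le> pkern n k c t"
proof -
  have "real n / c > 0" using assms by simp
  then have "Gamma (real n / c + real k) > 0" "Gamma (real n / c) > 0"
    by (auto intro!: Gamma_real_pos)
  with assms show ?thesis
    by (auto simp: pkern_def intro!: mult_nonneg_nonneg divide_nonneg_nonneg Gamma_real_nonneg)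
qed

section \<open>Error estimate for the operator\<close>

text \<open>Integrating the pointwise bound against the probability density \<open>P\<close> gives
  \<open>e\<close> plus \<open>K\<close> times the second moment about \<open>x\<close>, expanded
  through the raw moments.\<close>

lemma pkern_average_error:
  assumes c: "c > 0" and n: "real n > 3 * c"
    and f: "continuous_on {0..} f"
    and bound: "\<And>t. 0 \<le> t \<Longrightarrow> \<bar>f t - f x\<bar> \<le> e + K * (t - x)\<^sup>2"
  shows "\<bar>(real n - c) / c * (LINT t:{0..}|lborel. pkern n k c t * f t) - f x\<bar>
    \<le> e + K * (real (Suc k) * (real (Suc k) + 1) / ((real n - 2 * c) * (real n - 3 * c))
                - 2 * x * (real (Suc k) / (real n - 2 * c)) + x\<^sup>2)"
proof -
  define P where "P = (\<lambda>t. indicator {0..} t * ((real n - c) / c * pkern n k c t))"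
  let ?m1 = "real (Suc k) / (real n - 2 * c)"
  let ?m2 = "real (Suc k) * (real (Suc k) + 1) / ((real n - 2 * c) * (real n - 3 * c))"
  have P0: "has_bochner_integral lborel P 1"
    and P1: "has_bochner_integral lborel (\<lambda>t. P t * t) ?m1"
    and P2: "has_bochner_integral lborel (\<lambda>t. P t * t\<^sup>2) ?m2"
    unfolding P_def by (rule pkern_moments[OF c n])+
  have P_nonneg: "0 \<le> P t" for t
    using pkern_nonneg[of c n t k] c n by (auto simp: P_def indicator_def)
  have "has_bochner_integral lborel (\<lambda>t. e * P t + K * (P t * t\<^sup>2 - 2 * x * (P t * t) + x\<^sup>2 * P t))
      (e * 1 + K * (?m2 - 2 * x * ?m1 + x\<^sup>2 * 1))"
    by (intro has_bochner_integral_add has_bochner_integral_diff has_bochner_integral_mult_right P0 P1 P2)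
  also have "(\<lambda>t. e * P t + K * (P t * t\<^sup>2 - 2 * x * (P t * t) + x\<^sup>2 * P t)) = (\<lambda>t. P t * (e + K * (t - x)\<^sup>2))"
    by (simp add: algebra_simps power2_eq_square)
  finally have Q: "has_bochner_integral lborel (\<lambda>t. P t * (e + K * (t - x)\<^sup>2)) (e + K * (?m2 - 2 * x * ?m1 + x\<^sup>2))"
    by simp
  have P_meas: "P \<in> borel_measurable lborel"
    using P0 by (intro borel_measurable_integrable) (auto simp: has_bochner_integral_iff)
  have f_meas: "(\<lambda>t. indicator {0..} t * f t) \<in> borel_measurable lborel"
    using borel_measurable_continuous_on_indicator[OF _ f] by simp
  \<comment> \<open>\<open>P\<close> vanishes on negative arguments, so measurability of
    \<open>f\<close> on the half-line suffices.\<close>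
  have P_ind: "P t * g = P t * (indicator {0..} t * g)" for t g
    by (simp add: P_def indicator_def)
  have "(\<lambda>t. P t * (indicator {0..} t * f t) - P t * f x) \<in> borel_measurable lborel"
    using P_meas f_meas by measurable
  then have meas: "(\<lambda>t. P t * (f t - f x)) \<in> borel_measurable lborel"
    by (simp only: P_ind[symmetric] right_diff_distrib)
  have le: "norm (P t * (f t - f x)) \<le> P t * (e + K * (t - x)\<^sup>2)" for t
  proof (cases "0 \<le> t")
    case True
    then show ?thesis using bound[of t] P_nonneg[of t] by (simp add: abs_mult mult_left_mono)
  qed (simp add: P_def)
  have Q_int: "integrable lborel (\<lambda>t. P t * (e + K * (t - x)\<^sup>2))"
    using Q by (simp only: has_bochner_integral_iff)
  have int: "integrable lborel (\<lambda>t. P t * (f t - f x))"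
    by (rule Bochner_Integration.integrable_bound[OF Q_int meas])
       (rule AE_I2, rule order_trans[OF le], simp)
  have "(LINT t|lborel. P t * (f t - f x)) + (LINT t|lborel. P t * f x)
      = (LINT t|lborel. P t * (f t - f x) + P t * f x)"
    using int P0 by (intro Bochner_Integration.integral_add[symmetric]) (auto simp: has_bochner_integral_iff)
  also have "\<dots> = (LINT t|lborel. (real n - c) / c * (indicator {0..} t * (pkern n k c t * f t)))"
  proof (intro Bochner_Integration.integral_cong refl)
    fix t
    have "P t * (f t - f x) + P t * f x = P t * f t" by (simp add: right_diff_distrib)
    then show "P t * (f t - f x) + P t * f x = (real n - c) / c * (indicator {0..} t * (pkern n k c t * f t))"
      by (simp only: P_def mult_ac)
  qed
  also have "\<dots> = (real n - c) / c * (LINT t:{0..}|lborel. pkern n k c t * f t)"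
    by (simp only: integral_mult_right_zero set_lebesgue_integral_def real_scaleR_def)
  finally have "(real n - c) / c * (LINT t:{0..}|lborel. pkern n k c t * f t) - f x
      = (LINT t|lborel. P t * (f t - f x))"
    using P0 by (simp add: has_bochner_integral_iff)
  also have "\<bar>\<dots>\<bar> \<le> (LINT t|lborel. \<bar>P t * (f t - f x)\<bar>)"
    using integral_norm_bound[of lborel "\<lambda>t. P t * (f t - f x)"] by simp
  also have "\<dots> \<le> (LINT t|lborel. P t * (e + K * (t - x)\<^sup>2))"
  proof (rule integral_mono)
    show "integrable lborel (\<lambda>t. \<bar>P t * (f t - f x)\<bar>)" using int by (rule integrable_abs)
    show "integrable lborel (\<lambda>t. P t * (e + K * (t - x)\<^sup>2))" by (rule Q_int)
    show "\<bar>P t * (f t - f x)\<bar> \<le> P t * (e + K * (t - x)\<^sup>2)" for t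
      using le[of t] by (simp only: real_norm_def)
  qed
  also have "\<dots> = e + K * (?m2 - 2 * x * ?m1 + x\<^sup>2)"
    using Q by (simp only: has_bochner_integral_iff)
  finally show ?thesis .
qed

text \<open>The kernel errors are summed with the weights, and the atom at \<open>0\<close> of mass
  \<open>exp (- z)\<close> is added. The total mass is \<open>1\<close>, so \<open>e\<close>
  survives unchanged and \<open>K\<close> is multiplied by the variance.\<close>

lemma Dop_error:
  assumes c: "c > 0" and n: "real n > 3 * c" and \<beta>: "0 \<le> \<beta>" "\<beta> \<le> 1/16" and x: "0 \<le> x"
    and f: "continuous_on {0..} f" and K: "0 \<le> K"
    and bound: "\<And>t. 0 \<le> t \<Longrightarrow> \<bar>f t - f x\<bar> \<le> e + K * (t - x)\<^sup>2"
  shows "\<bar>Dop n c \<beta> f x - f x\<bar> \<le> e + K * ((c * x\<^sup>2 + 3 * x) / (real n - 3 * c))"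
proof -
  define A where "A = real n - 2 * c"
  define D where "D = real n - 3 * c"
  have A: "A > 0" "D > 0" "A = D + c" using n c by (auto simp: A_def D_def)
  define z where "z = A * (1 - \<beta>) * x"
  have z: "0 \<le> z" using A \<beta> x by (simp add: z_def)
  have nr: "real n * r_n n c \<beta> x = z"
    using n c by (simp add: r_n_def z_def A_def)
  define \<omega> where "\<omega> = (\<lambda>k. omega \<beta> (Suc k) z)"
  have \<omega>_nonneg: "0 \<le> \<omega> k" for k using \<beta> z by (simp add: \<omega>_def omega_nonneg)
  \<comment> \<open>The King-type scaling in \<open>r_n\<close> cancels \<open>1 - \<beta>\<close>;
    dividing by \<open>A\<close>, as the kernel means do, gives mean exactly
    \<open>x\<close>.\<close>
  have mean: "z / (1 - \<beta>) = A * x" using \<beta> by (simp add: z_def)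
  have var: "z / (1 - \<beta>) ^ 3 = A * x / (1 - \<beta>)\<^sup>2"
    using \<beta> by (simp add: z_def power2_eq_square power3_eq_cube)
  have \<omega>: "omega \<beta> (Suc k) z = \<omega> k" for k by (simp add: \<omega>_def)
  note M = omega_moments[OF \<beta> z, unfolded \<omega> mean var]
  \<comment> \<open>\<open>m k\<close> is the mean square deviation from \<open>x\<close> under the
    \<open>k\<close>-th kernel, \<open>V\<close> that of the whole measure, atom included.\<close>
  define m where "m = (\<lambda>k. real (Suc k) * (real (Suc k) + 1) / (A * D) - 2 * x * (real (Suc k) / A) + x\<^sup>2)"
  define V where "V = x\<^sup>2 * (c / D) + x * (1 + 1 / (1 - \<beta>)\<^sup>2) / D"
  have "(\<lambda>k. (e + K * x\<^sup>2) * \<omega> k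
          + K * (1 / (A * D) * (\<omega> k * (real (Suc k))\<^sup>2) + (1 / (A * D) - 2 * x / A) * (\<omega> k * real (Suc k))))
     sums ((e + K * x\<^sup>2) * (1 - exp (- z))
          + K * (1 / (A * D) * ((A * x)\<^sup>2 + A * x / (1 - \<beta>)\<^sup>2) + (1 / (A * D) - 2 * x / A) * (A * x)))"
    by (intro sums_add sums_mult M)
  also have "(\<lambda>k. (e + K * x\<^sup>2) * \<omega> k
          + K * (1 / (A * D) * (\<omega> k * (real (Suc k))\<^sup>2) + (1 / (A * D) - 2 * x / A) * (\<omega> k * real (Suc k))))
      = (\<lambda>k. \<omega> k * (e + K * m k))"
    using A by (intro ext) (simp add: m_def power2_eq_square divide_inverse ring_distribs mult_ac)
  also have "1 / (A * D) * ((A * x)\<^sup>2 + A * x / (1 - \<beta>)\<^sup>2) + (1 / (A * D) - 2 * x / A) * (A * x) = V - x\<^sup>2"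
  proof -
    have "1 / (A * D) * ((A * x)\<^sup>2 + A * x / (1 - \<beta>)\<^sup>2) + (1 / (A * D) - 2 * x / A) * (A * x)
        = x\<^sup>2 * (A / D) + x * (1 + 1 / (1 - \<beta>)\<^sup>2) / D - 2 * x\<^sup>2"
    proof -
      define r where "r = 1 / (1 - \<beta>)\<^sup>2"
      have r: "A * x / (1 - \<beta>)\<^sup>2 = A * x * r" by (simp add: r_def)
      show ?thesis
        unfolding r r_def[symmetric] using A(1,2) by (simp add: field_simps power2_eq_square)
    qed
    also have "A / D = 1 + c / D" using A by (simp add: add_divide_distrib)
    finally show ?thesis by (simp add: V_def algebra_simps)
  qed
  finally have S: "(\<lambda>k. \<omega> k * (e + K * m k)) sums ((e + K * x\<^sup>2) * (1 - exp (- z)) + K * (V - x\<^sup>2))" .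
  define q where "q = (\<lambda>k. (real n - c) / c * (LINT t:{0..}|lborel. pkern n k c t * f t))"
  have q: "\<bar>q k - f x\<bar> \<le> e + K * m k" for k
    using pkern_average_error[OF c n f bound] by (simp only: q_def m_def A_def D_def)
  have le: "norm (\<omega> k * (q k - f x)) \<le> \<omega> k * (e + K * m k)" for k
    using q \<omega>_nonneg by (simp add: abs_mult mult_left_mono)
  have summ: "summable (\<lambda>k. \<omega> k * (q k - f x))"
    by (rule summable_comparison_test[OF _ sums_summable[OF S]]) (use le in blast)
  have "(\<lambda>k. \<omega> k * (q k - f x) + f x * \<omega> k) sums ((\<Sum>k. \<omega> k * (q k - f x)) + f x * (1 - exp (- z)))"
    by (intro sums_add sums_mult summable_sums summ M)
  also have "(\<lambda>k. \<omega> k * (q k - f x) + f x * \<omega> k) = (\<lambda>k. \<omega> k * q k)"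
    by (simp add: algebra_simps)
  finally have sums_q: "(\<lambda>k. \<omega> k * q k) sums ((\<Sum>k. \<omega> k * (q k - f x)) + f x * (1 - exp (- z)))" .
  \<comment> \<open>\<open>Dop\<close> carries this factor outside the series while \<open>q\<close>
    contains it, so it has to be divided out.\<close>
  have nc: "(real n - c) / c \<noteq> 0" using n c by simp
  have "(\<lambda>k. \<omega> k * (LINT t:{0..}|lborel. pkern n k c t * f t))
      sums (((\<Sum>k. \<omega> k * (q k - f x)) + f x * (1 - exp (- z))) / ((real n - c) / c))"
    using sums_divide[OF sums_q, of "(real n - c) / c"] nc by (simp add: q_def)
  then have "Dop n c \<beta> f x = (\<Sum>k. \<omega> k * (q k - f x)) + f x * (1 - exp (- z)) + exp (- z) * f 0"
    using nc by (simp add: Dop_def nr \<omega>_def sums_iff)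
  then have "Dop n c \<beta> f x - f x = (\<Sum>k. \<omega> k * (q k - f x)) + exp (- z) * (f 0 - f x)"
    by (simp add: algebra_simps)
  also have "\<bar>\<dots>\<bar> \<le> \<bar>\<Sum>k. \<omega> k * (q k - f x)\<bar> + exp (- z) * \<bar>f 0 - f x\<bar>"
    by (rule order_trans[OF abs_triangle_ineq]) (simp add: abs_mult)
  \<comment> \<open>The atom deviates from \<open>x\<close> by exactly \<open>x\<close>; its term
    \<open>K * x\<^sup>2\<close> restores what the weights of total mass
    \<open>1 - exp (- z)\<close> lack.\<close>
  also have "\<dots> \<le> ((e + K * x\<^sup>2) * (1 - exp (- z)) + K * (V - x\<^sup>2)) + exp (- z) * (e + K * x\<^sup>2)"
  proof (rule add_mono)
    show "\<bar>\<Sum>k. \<omega> k * (q k - f x)\<bar> \<le> (e + K * x\<^sup>2) * (1 - exp (- z)) + K * (V - x\<^sup>2)"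
      using norm_suminf_le[OF le sums_summable[OF S]]
      by (simp only: sums_unique[OF S, symmetric] real_norm_def)
    show "exp (- z) * \<bar>f 0 - f x\<bar> \<le> exp (- z) * (e + K * x\<^sup>2)"
      using bound[of 0] by (intro mult_left_mono) auto
  qed
  also have "\<dots> = e + K * V" by (simp add: algebra_simps)
  also have "\<dots> \<le> e + K * ((c * x\<^sup>2 + 3 * x) / D)"
  proof -
    \<comment> \<open>The constant \<open>3\<close> comes from
      \<open>1 + 1 / (1 - \<beta>)\<^sup>2\<close> and the crude bound \<open>1/2\<close> for
      \<open>(1 - \<beta>)\<^sup>2\<close>.\<close>
    have "(15/16)\<^sup>2 \<le> (1 - \<beta>)\<^sup>2" using \<beta> by (intro power_mono) auto
    then have "1/2 \<le> (1 - \<beta>)\<^sup>2" by (simp add: power2_eq_square)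
    then have "1 / (1 - \<beta>)\<^sup>2 \<le> 1 / (1/2)" by (intro divide_left_mono) auto
    then have "x * (1 + 1 / (1 - \<beta>)\<^sup>2) \<le> x * 3" using x by (intro mult_left_mono) auto
    then have "V \<le> x\<^sup>2 * (c / D) + x * 3 / D"
      unfolding V_def using A by (intro add_left_mono divide_right_mono) auto
    then have "V \<le> (c * x\<^sup>2 + 3 * x) / D" by (simp add: add_divide_distrib mult_ac)
    then show ?thesis using K by (intro add_left_mono mult_left_mono)
  qed
  finally show ?thesis by (simp only: D_def)
qed

section \<open>Uniform convergence on compact sets\<close>

text \<open>Close to \<open>x\<close> uniform continuity gives \<open>e\<close>; at distance at
  least \<open>\<delta>\<close> the quadratic growth of \<open>f\<close> is absorbed by a multiple
  of \<open>(t - x)\<^sup>2\<close>, with constants depending on \<open>b\<close> but not on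
  \<open>x\<close>.\<close>

lemma quadratic_majorant:
  fixes f :: "real \<Rightarrow> real"
  assumes f: "continuous_on {0..} f" and growth: "\<And>t. 0 \<le> t \<Longrightarrow> \<bar>f t\<bar> \<le> M * (1 + t\<^sup>2)"
    and e: "e > 0"
  obtains K where "0 \<le> K"
    "\<And>t x. 0 \<le> t \<Longrightarrow> 0 \<le> x \<Longrightarrow> x \<le> b \<Longrightarrow> \<bar>f t - f x\<bar> \<le> e + K * (t - x)\<^sup>2"
proof -
  have M: "0 \<le> M" using growth[of 0] by simp
  have "uniformly_continuous_on {0..b + 1} f"
    by (intro compact_uniformly_continuous continuous_on_subset[OF f]) auto
  then obtain d where d: "d > 0"
    "\<And>x t. x \<in> {0..b + 1} \<Longrightarrow> t \<in> {0..b + 1} \<Longrightarrow> \<bar>t - x\<bar> < d \<Longrightarrow> \<bar>f t - f x\<bar> < e"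
    using e unfolding uniformly_continuous_on_def dist_real_def by metis
  \<comment> \<open>The cap \<open>1\<close> keeps every \<open>t\<close> closer than
    \<open>\<delta>\<close> to some \<open>x \<le> b\<close> inside
    \<open>{0..b + 1}\<close>.\<close>
  define \<delta> where "\<delta> = min d 1"
  have \<delta>: "0 < \<delta>" "\<delta> \<le> d" "\<delta> \<le> 1" using d by (auto simp: \<delta>_def)
  define C where "C = M * (2 + 3 * b\<^sup>2)"
  have C: "0 \<le> C" using M by (simp add: C_def)
  define K where "K = C / \<delta>\<^sup>2 + 2 * M"
  have K: "0 \<le> K" using C M by (simp add: K_def)
  show thesis
  proof (rule that[OF K])
    fix t x :: real
    assume t: "0 \<le> t" and x: "0 \<le> x" "x \<le> b"
    show "\<bar>f t - f x\<bar> \<le> e + K * (t - x)\<^sup>2"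
    proof (cases "\<bar>t - x\<bar> < \<delta>")
      case True
      then have "\<bar>f t - f x\<bar> < e" using t x \<delta> by (intro d) auto
      moreover have "0 \<le> K * (t - x)\<^sup>2" using K by simp
      ultimately show ?thesis by linarith
    next
      case False
      then have far: "\<delta>\<^sup>2 \<le> (t - x)\<^sup>2"
        using \<delta> abs_le_square_iff[of \<delta> "t - x"] by simp
      have xb: "x\<^sup>2 \<le> b\<^sup>2" using x by (intro power_mono) auto
      \<comment> \<open>The difference of the two sides is
        \<open>(t - 2 * x)\<^sup>2\<close>.\<close>
      have "t\<^sup>2 \<le> 2 * (t - x)\<^sup>2 + 2 * x\<^sup>2"
        using zero_le_power2[of "t - 2 * x"] by (simp add: power2_eq_square algebra_simps)
      then have "(1 + t\<^sup>2) + (1 + x\<^sup>2) \<le> (2 + 3 * b\<^sup>2) + 2 * (t - x)\<^sup>2" using xb by linarith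
      then have "M * ((1 + t\<^sup>2) + (1 + x\<^sup>2)) \<le> M * ((2 + 3 * b\<^sup>2) + 2 * (t - x)\<^sup>2)"
        using M by (rule mult_left_mono)
      then have "\<bar>f t - f x\<bar> \<le> C + 2 * M * (t - x)\<^sup>2"
        using growth[OF t] growth[OF x(1)] unfolding C_def ring_distribs by linarith
      also have "C = C / \<delta>\<^sup>2 * \<delta>\<^sup>2" using \<delta> by simp
      also have "\<dots> \<le> C / \<delta>\<^sup>2 * (t - x)\<^sup>2" using far C by (intro mult_left_mono) auto
      finally show ?thesis using e by (simp add: K_def algebra_simps)
    qed
  qed
qed

theorem theorem6:
  fixes c :: real and \<beta> :: "nat \<Rightarrow> real" and B :: "real set" and f :: "real \<Rightarrow> real"
  assumes "c > 0"
    and "\<And>n. 0 \<le> \<beta> n \<and> \<beta> n < 1"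
    and "\<beta> \<longlonglongrightarrow> 0"
    and "compact B" and "B \<subseteq> {0..}"
    and "f \<in> C_rho0"
  shows "uniform_limit B (\<lambda>n x. Dop n c (\<beta> n) f x) f sequentially"
proof (rule uniform_limitI)
  fix e :: real
  assume "e > 0"
  obtain M where f: "continuous_on {0..} f" and M: "\<And>t. 0 \<le> t \<Longrightarrow> \<bar>f t\<bar> \<le> M * (1 + t\<^sup>2)"
    using assms(6) by (auto simp: C_rho0_def)
  obtain b where b: "\<And>x. x \<in> B \<Longrightarrow> \<bar>x\<bar> \<le> b"
    using compact_imp_bounded[OF assms(4)] by (auto simp: bounded_iff)
  obtain K where K: "0 \<le> K"
    and maj: "\<And>t x. 0 \<le> t \<Longrightarrow> 0 \<le> x \<Longrightarrow> x \<le> b \<Longrightarrow> \<bar>f t - f x\<bar> \<le> e / 2 + K * (t - x)\<^sup>2"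
    using quadratic_majorant[OF f M, of "e / 2" b] \<open>e > 0\<close> by auto
  have "filterlim (\<lambda>n. - 3 * c + real n) at_top sequentially"
    by (intro filterlim_tendsto_add_at_top[OF tendsto_const] filterlim_real_sequentially)
  then have D: "filterlim (\<lambda>n. real n - 3 * c) at_top sequentially" by simp
  have "((\<lambda>n. K * ((c * b\<^sup>2 + 3 * b) / (real n - 3 * c))) \<longlongrightarrow> K * 0) sequentially"
    by (intro tendsto_mult tendsto_const real_tendsto_divide_at_top[OF tendsto_const D])
  then have small: "\<forall>\<^sub>F n in sequentially. K * ((c * b\<^sup>2 + 3 * b) / (real n - 3 * c)) < e / 2"
    using \<open>e > 0\<close> by (intro order_tendstoD) auto
  have "\<forall>\<^sub>F n in sequentially. \<beta> n < 1/16"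
    using assms(3) by (rule order_tendstoD) auto
  moreover have "\<forall>\<^sub>F n in sequentially. real n - 3 * c > 0"
    using D[unfolded filterlim_at_top_dense] by blast
  ultimately show "\<forall>\<^sub>F n in sequentially. \<forall>x\<in>B. dist (Dop n c (\<beta> n) f x) (f x) < e"
    using small
  proof eventually_elim
    case (elim n)
    show ?case
    proof
      fix x
      assume "x \<in> B"
      then have x: "0 \<le> x" "x \<le> b" using assms(5) b[of x] by auto
      have "\<bar>Dop n c (\<beta> n) f x - f x\<bar> \<le> e / 2 + K * ((c * x\<^sup>2 + 3 * x) / (real n - 3 * c))"
        using elim assms(2)[of n] x by (intro Dop_error assms(1) f K maj) auto
      \<comment> \<open>The variance bound increases with \<open>x \<ge> 0\<close>, so its value at
        \<open>b\<close> serves all of \<open>B\<close> at once.\<close>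
      also have "\<dots> \<le> e / 2 + K * ((c * b\<^sup>2 + 3 * b) / (real n - 3 * c))"
        using elim x assms(1) K
        by (intro add_left_mono mult_left_mono divide_right_mono add_mono power_mono) auto
      also have "\<dots> < e" using elim by linarith
      finally show "dist (Dop n c (\<beta> n) f x) (f x) < e" by (simp add: dist_real_def)
    qed
  qed
qed

end
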